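(* In the RESTART model with task time distribution $F$, failure time distribution $G$ and total time $X$, assume that $F=G$. Then $$\overline H(x)\ \sim\ \frac{1}{\mu x},\qquad x\to\infty .$$
   Context: RESTART model: $T$ is a nonnegative random variable (task time) with distribution $F$ having density $f$ on $[0,\infty)$. $U, U_1,U_2,\ldots$ are nonnegative i.i.d. random variables (failure times) with distribution $G$ having density $g$, independent of $T$. $N=\inf\{n\ge 0:\,U_{n+1}>T\}$, $S=\sum_{i=1}^N U_i$, and the total time is $X=T+S$ (with $X=\infty$ if $N=\infty$). Write $\overline F(t)=\mathbb P(T>t)$, $\overline G(t)=\mathbb P(U>t)$, $\overline H(x)=\mathbb P(X>x)$. Set $\mu=1/\mathbb E U$. Standing assumptions: $\mu>0$ (i.e. $\mathbb E U<\infty$) and the support of $F$ is unbounded. $a(x)\sim b(x)$ means $a(x)/b(x)\to1$. *)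

theory Defs
  imports "HOL-Probability.Probability" "HOL-Library.Landau_Symbols" "HOL-Library.Extended_Nat"
begin

text \<open>
  \<open>F\<close> and \<open>G\<close> are distributions as Borel measures on the real line, and \<open>f\<close>, \<open>g\<close> are
  densities on \<open>[0, \<infinity>)\<close> (their values at negative arguments are irrelevant).
  The failure times are \<open>U 1, U 2, \<dots>\<close>; \<open>U 0\<close> is unused and unconstrained.
  Independence of the \<open>U n\<close> among each other and of \<open>T\<close> from the whole sequence is
  joint independence of \<open>T, U 1, U 2, \<dots>\<close>, where \<open>T\<close> takes index \<open>0\<close>.
\<close>

locale restart_model = prob_space M
  for M :: "'a measure"
    and T :: "'a \<Rightarrow> real" and U :: "nat \<Rightarrow> 'a \<Rightarrow> real"
    and F G :: "real measure" and f g :: "real \<Rightarrow> real" +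
  assumes T_rv: "random_variable borel T"
    and U_rv: "\<And>n. n \<ge> 1 \<Longrightarrow> random_variable borel (U n)"
    and T_nonneg: "\<And>\<omega>. \<omega> \<in> space M \<Longrightarrow> T \<omega> \<ge> 0"
    and U_nonneg: "\<And>n \<omega>. n \<ge> 1 \<Longrightarrow> \<omega> \<in> space M \<Longrightarrow> U n \<omega> \<ge> 0"
    and T_distr: "distr M borel T = F"
    and U_distr: "\<And>n. n \<ge> 1 \<Longrightarrow> distr M borel (U n) = G"
    and f_nonneg: "\<And>t. t \<ge> 0 \<Longrightarrow> f t \<ge> 0"
    and g_nonneg: "\<And>t. t \<ge> 0 \<Longrightarrow> g t \<ge> 0"
    and T_density: "distributed M lborel T (\<lambda>t. ennreal (f t) * indicator {0..} t)"
    and U_density: "\<And>n. n \<ge> 1 \<Longrightarrow>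
          distributed M lborel (U n) (\<lambda>t. ennreal (g t) * indicator {0..} t)"
    and indep: "indep_vars (\<lambda>_. borel) (\<lambda>n. if n = 0 then T else U n) UNIV"

text \<open>The infimum is taken in \<^typ>\<open>enat\<close>, so it is \<open>\<infinity>\<close> when no failure time exceeds \<open>T\<close>.\<close>

definition restart_N :: "('a \<Rightarrow> real) \<Rightarrow> (nat \<Rightarrow> 'a \<Rightarrow> real) \<Rightarrow> 'a \<Rightarrow> enat" where
  "restart_N T U \<omega> = Inf {enat n | n. U (n + 1) \<omega> > T \<omega>}"

text \<open>Setting \<open>S = \<infinity>\<close> for \<open>N = \<infinity>\<close> implements the convention that \<open>X = \<infinity>\<close> in that case.\<close>

definition restart_S :: "('a \<Rightarrow> real) \<Rightarrow> (nat \<Rightarrow> 'a \<Rightarrow> real) \<Rightarrow> 'a \<Rightarrow> ereal" where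
  "restart_S T U \<omega> =
     (case restart_N T U \<omega> of enat n \<Rightarrow> ereal (\<Sum>i=1..n. U i \<omega>) | \<infinity> \<Rightarrow> \<infinity>)"

definition restart_X :: "('a \<Rightarrow> real) \<Rightarrow> (nat \<Rightarrow> 'a \<Rightarrow> real) \<Rightarrow> 'a \<Rightarrow> ereal" where
  "restart_X T U \<omega> = ereal (T \<omega>) + restart_S T U \<omega>"

definition restart_Hbar :: "'a measure \<Rightarrow> ('a \<Rightarrow> real) \<Rightarrow> (nat \<Rightarrow> 'a \<Rightarrow> real) \<Rightarrow> real \<Rightarrow> real" where
  "restart_Hbar M T U x = measure M {\<omega> \<in> space M. restart_X T U \<omega> > ereal x}"

definition measure_support :: "'b::topological_space measure \<Rightarrow> 'b set" where
  "measure_support P = {x. \<forall>A. open A \<longrightarrow> x \<in> A \<longrightarrow> emeasure P A > 0}"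

end

theory Submission
  imports Defs
begin

text \<open>
  Put \<open>V 0 = T\<close> and \<open>V n = U n\<close> for \<open>n \<ge> 1\<close>. As \<open>F = G\<close>, this is one i.i.d. sequence,
  without ties because its law has a density. With \<open>S n = V 0 + \<dots> + V n\<close>, the total time exceeds
  \<open>x\<close> exactly when no term exceeds \<open>V 0\<close> until the partial sums have passed \<open>x\<close>
  (\<open>restart_X_gt_iff\<close>). The first passage happens at about \<open>\<mu> x\<close> terms, and by exchangeability the first
  of \<open>n\<close> terms is their maximum with probability \<open>1/n\<close>; this is the heuristic for \<open>1 / (\<mu> x)\<close>.

  A stopped sum is not an exchangeable function of its terms, so the proof compares with deterministic
  numbers of terms. For these, exchangeability gives more: being the largest of the first terms
  is uncorrelated with every function of a sum that contains all of them (\<open>expectation_leads\<close>). The weak law of large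
  numbers then yields the lower bound at once, by using slightly more than \<open>\<mu> x\<close> terms.

  For the upper bound (\<open>prob_outlasts_le\<close>) let \<open>l\<close> be slightly less than \<open>\<mu> x\<close> and \<open>k\<close> a small
  multiple of \<open>x\<close>. If \<open>S l \<le> x\<close>, then \<open>V 0\<close> is the maximum of the first \<open>l + 1\<close> terms, which gives the main
  contribution. If \<open>S k \<le> x < S l\<close>, then \<open>V 0\<close> is the maximum of \<open>k + 1\<close> terms while \<open>S l\<close> is
  atypically large, which costs \<open>o(1/x)\<close>. The case \<open>S k > x\<close> is the delicate one, since a heavy tail
  makes the expected reciprocal of the passage index hard to control. Either \<open>V 0 > x / 2\<close>,
  which has probability \<open>o(1/x)\<close> because the mean is finite, or at least two terms contribute substantially to
  the sum up to the passage. In the latter case the sum of the products of pairs of terms is at least \<open>x\<^sup>2/4\<close>, and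
  the expectation of this sum, restricted to \<open>V 0\<close> being the maximum so far, is only linear in \<open>k\<close>
  (\<open>prob_early_crossing\<close>).
\<close>

section \<open>Auxiliary facts\<close>

lemma pred_coordinate_is_max:
  assumes "finite J" "J \<subseteq> K" "j \<in> K"
  shows "Measurable.pred (\<Pi>\<^sub>M i\<in>K. borel) (\<lambda>y. \<forall>i\<in>J. y i \<le> (y j :: real))"
proof (rule pred_intros_finite)
  fix i assume "i \<in> J"
  hence "i \<in> K" using assms by auto
  thus "Measurable.pred (\<Pi>\<^sub>M i\<in>K. borel) (\<lambda>y. y i \<le> (y j :: real))"
    unfolding pred_def using assms
    by (intro borel_measurable_le measurable_component_singleton)
qed fact

lemma sum_increment_times_partial_sum:
  fixes v :: "nat \<Rightarrow> real"
  shows "2 * (\<Sum>j<n. v (Suc j) * (\<Sum>i\<le>j. v i)) = (\<Sum>i\<le>n. v i)\<^sup>2 - (\<Sum>i\<le>n. (v i)\<^sup>2)"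
  by (induction n) (simp_all add: power2_eq_square algebra_simps)

lemma filterlim_nat_floor_mult:
  assumes "(a :: real) > 0"
  shows "filterlim (\<lambda>x. nat \<lfloor>a * x\<rfloor>) at_top at_top"
proof -
  have "filterlim (\<lambda>x. a * x) at_top at_top"
    using assms by (intro filterlim_tendsto_pos_mult_at_top[OF tendsto_const]) (auto simp: filterlim_ident)
  thus ?thesis
    by (rule filterlim_compose[OF filterlim_nat_sequentially filterlim_compose[OF filterlim_floor_sequentially]])
qed

section \<open>Diffuse i.i.d. sequences and exchangeability\<close>

text \<open>
  Index \<open>0\<close> stands for the task time and the later indices for the failure times. Diffuseness rules out
  ties, so that the maximum of finitely many terms is almost surely attained by exactly one of them.
\<close>
locale iid_diffuse_sequence = prob_space M
  for M :: "'a measure" +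
  fixes V :: "nat \<Rightarrow> 'a \<Rightarrow> real" and D :: "real measure"
  assumes indep: "indep_vars (\<lambda>_. borel) V UNIV"
    and distr_V: "distr M borel (V i) = D"
    and V_nonneg: "\<omega> \<in> space M \<Longrightarrow> V i \<omega> \<ge> 0"
    and diffuse: "emeasure D {a} = 0"
    and integrable_V0: "integrable M (V 0)"
begin

definition S :: "nat \<Rightarrow> 'a \<Rightarrow> real" where
  "S n \<omega> = (\<Sum>i\<le>n. V i \<omega>)"

definition leads :: "nat \<Rightarrow> 'a \<Rightarrow> bool" where
  "leads k \<omega> \<longleftrightarrow> (\<forall>i\<le>k. V i \<omega> \<le> V 0 \<omega>)"

text \<open>
  The event that the total time exceeds \<open>x\<close>, expressed without the random number of failures: every
  failure time that starts at or before level \<open>x\<close> of the partial sums fails to exceed the task time.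
\<close>
definition outlasts :: "real \<Rightarrow> 'a \<Rightarrow> bool" where
  "outlasts x \<omega> \<longleftrightarrow> (\<forall>n. S n \<omega> \<le> x \<longrightarrow> V (Suc n) \<omega> \<le> V 0 \<omega>)"

definition mean :: real where
  "mean = expectation (V 0)"

lemma V_measurable [measurable]: "V i \<in> borel_measurable M"
  using indep by (auto simp: indep_vars_def)

lemma S_measurable [measurable]: "S n \<in> borel_measurable M"
  unfolding S_def by measurable

lemma leads_measurable [measurable]: "Measurable.pred M (leads k)"
  unfolding leads_def by measurable

lemma outlasts_measurable [measurable]: "Measurable.pred M (outlasts x)"
  unfolding outlasts_def by measurable

lemma prob_space_D: "prob_space D"
  unfolding distr_V[of 0, symmetric] by (rule prob_space_distr) (rule V_measurable)

lemma integrable_V [simp]: "integrable M (V i)"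
proof -
  have "integrable (distr M borel (V 0)) (\<lambda>x. x)"
    using integrable_V0 by (simp add: integrable_distr_eq)
  hence "integrable (distr M borel (V i)) (\<lambda>x. x)"
    by (simp only: distr_V)
  thus ?thesis by (simp add: integrable_distr_eq)
qed

lemma expectation_distr_V:
  assumes [measurable]: "h \<in> borel_measurable borel"
  shows "expectation (\<lambda>\<omega>. h (V i \<omega>) :: real) = expectation (\<lambda>\<omega>. h (V j \<omega>))"
proof -
  have "expectation (\<lambda>\<omega>. h (V i \<omega>)) = (\<integral>x. h x \<partial>D)" for i
    by (subst distr_V[symmetric, of i]) (simp add: integral_distr)
  thus ?thesis by simp
qed

lemma expectation_V: "expectation (V i) = mean"
  unfolding mean_def using expectation_distr_V[of "\<lambda>x. x" i 0] by simp

lemma integrable_S [simp]: "integrable M (S n)"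
  unfolding S_def by auto

lemma expectation_S: "expectation (S n) = real (Suc n) * mean"
  unfolding S_def by (simp add: expectation_V)

lemma S_mono:
  assumes "\<omega> \<in> space M" "i \<le> j"
  shows "S i \<omega> \<le> S j \<omega>"
  unfolding S_def using assms by (intro sum_mono2) (auto intro: V_nonneg)

lemma S_nonneg: "\<omega> \<in> space M \<Longrightarrow> S n \<omega> \<ge> 0"
  unfolding S_def by (intro sum_nonneg) (auto intro: V_nonneg)

text \<open>
  Exchangeability, by invariance of an infinite power of \<open>D\<close> under a relabelling of its
  coordinates.
\<close>
lemma expectation_reindex:
  assumes h: "h \<in> borel_measurable (\<Pi>\<^sub>M i\<in>UNIV. borel)" and "inj \<pi>"
  shows "expectation (\<lambda>\<omega>. h (\<lambda>i. V (\<pi> i) \<omega>) :: real) = expectation (\<lambda>\<omega>. h (\<lambda>i. V i \<omega>))"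
proof -
  let ?B = "\<Pi>\<^sub>M i\<in>(UNIV :: nat set). (borel :: real measure)"
  let ?P = "\<Pi>\<^sub>M i\<in>(UNIV :: nat set). D"
  have V_seq [measurable]: "(\<lambda>\<omega> i. V (\<rho> i) \<omega>) \<in> measurable M ?B" for \<rho> :: "nat \<Rightarrow> nat"
    by (rule measurable_PiM_single') auto
  have sets_D: "sets D = sets borel" using distr_V[of 0] by (metis sets_distr)
  have sets_P: "sets ?P = sets ?B"
    by (intro sets_PiM_cong) (auto simp: sets_D)
  have law: "distr M ?B (\<lambda>\<omega> i. V i \<omega>) = ?P"
    using indep_vars_iff_distr_eq_PiM[of "UNIV :: nat set" V "\<lambda>_. borel"] indep
    by (simp add: distr_V restrict_UNIV)
  have [measurable]: "(\<lambda>y i. y (\<pi> i)) \<in> measurable ?B ?B"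
    by (rule measurable_PiM_single') (auto simp: space_PiM)
  have "distr M ?B (\<lambda>\<omega> i. V (\<pi> i) \<omega>) = distr (distr M ?B (\<lambda>\<omega> i. V i \<omega>)) ?B (\<lambda>y i. y (\<pi> i))"
    by (subst distr_distr) (auto simp: comp_def)
  also have "\<dots> = distr ?P ?P (\<lambda>y i. y (\<pi> i))"
    unfolding law by (intro distr_cong) (auto simp: sets_P)
  also have "\<dots> = ?P"
    using distr_PiM_reindex[of UNIV "\<lambda>_. D" \<pi> UNIV] prob_space_D \<open>inj \<pi>\<close>
    by (simp add: restrict_def)
  finally have "distr M ?B (\<lambda>\<omega> i. V (\<pi> i) \<omega>) = distr M ?B (\<lambda>\<omega> i. V i \<omega>)"
    unfolding law .
  hence "integral\<^sup>L (distr M ?B (\<lambda>\<omega> i. V (\<pi> i) \<omega>)) h = integral\<^sup>L (distr M ?B (\<lambda>\<omega> i. V i \<omega>)) h"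
    by simp
  thus ?thesis
    unfolding integral_distr[OF V_seq[of \<pi>] h] integral_distr[OF V_seq[of "\<lambda>i. i"] h] .
qed

text \<open>
  By independence the pair has law \<open>D \<Otimes>\<^sub>M D\<close>, for which all sections of the diagonal are singletons.
\<close>
lemma AE_V_distinct:
  assumes "i \<noteq> j"
  shows "AE \<omega> in M. V i \<omega> \<noteq> V j \<omega>"
proof -
  interpret D: prob_space D by (rule prob_space_D)
  have sets_D [measurable_cong]: "sets D = sets borel" using distr_V[of 0] by (metis sets_distr)
  have "indep_var borel (V i) borel (V j)"
    using indep_vars_sum[of "{j}" i V] indep_vars_subset[OF indep] assms by simp
  hence law: "distr M (borel \<Otimes>\<^sub>M borel) (\<lambda>\<omega>. (V i \<omega>, V j \<omega>)) = D \<Otimes>\<^sub>M D"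
    unfolding indep_var_distribution_eq by (simp add: distr_V)
  have "{p \<in> space (borel \<Otimes>\<^sub>M borel). fst p = (snd p :: real)} \<in> sets (borel \<Otimes>\<^sub>M borel)"
    by measurable
  hence diag: "{p. fst p = (snd p :: real)} \<in> sets (borel \<Otimes>\<^sub>M borel)" 
    by (simp add: space_pair_measure)
  hence "emeasure (D \<Otimes>\<^sub>M D) {p. fst p = snd p} 
      = (\<integral>\<^sup>+x. emeasure D (Pair x -` {p. fst p = snd p}) \<partial>D)"
    by (intro D.emeasure_pair_measure_alt) (simp cong: sets_pair_measure_cong add: sets_D)
  also have "\<dots> = (\<integral>\<^sup>+x. emeasure D {x} \<partial>D)"
    by (intro nn_integral_cong arg_cong[of _ _ "emeasure D"]) auto
  finally have "emeasure (distr M (borel \<Otimes>\<^sub>M borel) (\<lambda>\<omega>. (V i \<omega>, V j \<omega>))) {p. fst p = snd p} = 0"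
    by (simp add: diffuse law)
  hence "emeasure M {\<omega> \<in> space M. V i \<omega> = V j \<omega>} = 0"
    using diag by (simp add: emeasure_distr vimage_def Int_def conj_commute)
  thus ?thesis by (subst AE_iff_measurable[OF _ refl]) auto
qed

text \<open>
  The source of the factor \<open>1/n\<close>. Exactly one of the first \<open>k + 1\<close> terms is the largest, and swapping it
  with the first term leaves \<open>S n\<close> unchanged as long as \<open>n \<ge> k\<close>. So each of the \<open>k + 1\<close> positions
  takes the same share of the expectation.
\<close>
lemma expectation_leads:
  assumes [measurable]: "\<phi> \<in> borel_measurable borel"
    and int: "integrable M (\<lambda>\<omega>. \<phi> (S n \<omega>) :: real)" and "k \<le> n"
  shows "expectation (\<lambda>\<omega>. \<phi> (S n \<omega>) * of_bool (leads k \<omega>)) = 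
           expectation (\<lambda>\<omega>. \<phi> (S n \<omega>)) / real (Suc k)"
proof -
  define L where "L l \<omega> = (of_bool (\<forall>i\<le>k. V i \<omega> \<le> V l \<omega>) :: real)" for l \<omega>
  have [measurable]: "L l \<in> borel_measurable M" for l
    unfolding L_def by measurable
  have intL: "integrable M (\<lambda>\<omega>. \<phi> (S n \<omega>) * L l \<omega>)" for l
    by (rule Bochner_Integration.integrable_bound[OF int]) (auto simp: L_def)
  have swap: "expectation (\<lambda>\<omega>. \<phi> (S n \<omega>) * L l \<omega>) = expectation (\<lambda>\<omega>. \<phi> (S n \<omega>) * L 0 \<omega>)" 
    if "l \<le> k" for l
  proof -
    let ?\<pi> = "Transposition.transpose 0 l"
    \<comment> \<open>Swapping positions \<open>0\<close> and \<open>l\<close> permutes \<open>{..k}\<close> and \<open>{..n}\<close>, so it fixes the sum and the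
       set of terms that are compared.\<close>
    define h :: "(nat \<Rightarrow> real) \<Rightarrow> real" where
      "h = (\<lambda>y. \<phi> (\<Sum>i\<le>n. y i) * of_bool (\<forall>i\<in>{..k}. y i \<le> y 0))"
    have perm: "bij_betw ?\<pi> {..j} {..j}" if "l \<le> j" for j
      using that by (intro bij_betw_transpose_iff) auto
    have "(\<Sum>i\<le>n. V (?\<pi> i) \<omega>) = S n \<omega>" for \<omega>
      unfolding S_def using \<open>l \<le> k\<close> \<open>k \<le> n\<close> by (intro sum.reindex_bij_betw perm) auto
    moreover have "(\<forall>i\<le>k. V (?\<pi> i) \<omega> \<le> V l \<omega>) \<longleftrightarrow> (\<forall>i\<le>k. V i \<omega> \<le> V l \<omega>)" for \<omega>
    proof -
      have "(\<forall>i\<le>k. V (?\<pi> i) \<omega> \<le> V l \<omega>) \<longleftrightarrow> (\<forall>i\<in>?\<pi> ` {..k}. V i \<omega> \<le> V l \<omega>)"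
        by auto
      also have "?\<pi> ` {..k} = {..k}"
        using perm[OF \<open>l \<le> k\<close>] by (simp only: bij_betw_def)
      finally show ?thesis unfolding Ball_def atMost_iff .
    qed
    ultimately have "h (\<lambda>i. V (?\<pi> i) \<omega>) = \<phi> (S n \<omega>) * L l \<omega>" for \<omega>
      by (simp add: h_def L_def Ball_def)
    moreover have "h (\<lambda>i. V i \<omega>) = \<phi> (S n \<omega>) * L 0 \<omega>" for \<omega>
      by (simp add: h_def L_def S_def Ball_def)
    moreover have "expectation (\<lambda>\<omega>. h (\<lambda>i. V (?\<pi> i) \<omega>)) = expectation (\<lambda>\<omega>. h (\<lambda>i. V i \<omega>))"
    proof (rule expectation_reindex[where h = h and \<pi> = ?\<pi>])
      show "h \<in> borel_measurable (\<Pi>\<^sub>M i\<in>UNIV. borel)"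
      proof -
        note pred_coordinate_is_max[measurable]
        show ?thesis unfolding h_def by measurable
      qed
    qed (rule inj_transpose)
    ultimately show ?thesis by simp
  qed
  have "AE \<omega> in M. \<forall>i. \<forall>j. i \<noteq> j \<longrightarrow> V i \<omega> \<noteq> V j \<omega>"
    by (auto simp: AE_all_countable intro: AE_V_distinct)
  hence "AE \<omega> in M. (\<Sum>l\<le>k. \<phi> (S n \<omega>) * L l \<omega>) = \<phi> (S n \<omega>)"
  proof eventually_elim
    case (elim \<omega>)
    have "Max ((\<lambda>i. V i \<omega>) ` {..k}) \<in> (\<lambda>i. V i \<omega>) ` {..k}"
      by (intro Max_in) auto
    then obtain l0 where l0: "Max ((\<lambda>i. V i \<omega>) ` {..k}) = V l0 \<omega>" "l0 \<in> {..k}"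
      by (rule imageE)
    have l0_max: "V i \<omega> \<le> V l0 \<omega>" if "i \<le> k" for i
      unfolding l0(1)[symmetric] using that by (intro Max_ge) auto
    have "L l \<omega> = of_bool (l = l0)" if "l \<le> k" for l
    proof -
      have "(\<forall>i\<le>k. V i \<omega> \<le> V l \<omega>) \<longleftrightarrow> l = l0"
      proof
        assume "\<forall>i\<le>k. V i \<omega> \<le> V l \<omega>"
        hence "V l0 \<omega> = V l \<omega>"
          using l0(2) l0_max[OF that] by (intro order_antisym) auto
        thus "l = l0" using elim[rule_format, of l0 l] by metis
      qed (use l0_max in blast)
      thus ?thesis by (simp only: L_def)
    qed
    hence "(\<Sum>l\<le>k. L l \<omega>) = (\<Sum>l\<le>k. of_bool (l = l0))"
      by (intro sum.cong) auto
    thus ?case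
      using l0(2) by (simp add: sum_distrib_left[symmetric] of_bool_def)
  qed
  hence "expectation (\<lambda>\<omega>. \<phi> (S n \<omega>)) = expectation (\<lambda>\<omega>. \<Sum>l\<le>k. \<phi> (S n \<omega>) * L l \<omega>)"
    by (intro integral_cong_AE) auto
  also have "\<dots> = (\<Sum>l\<le>k. expectation (\<lambda>\<omega>. \<phi> (S n \<omega>) * L l \<omega>))"
    by (rule Bochner_Integration.integral_sum) (rule intL)
  also have "\<dots> = (\<Sum>l\<le>k. expectation (\<lambda>\<omega>. \<phi> (S n \<omega>) * L 0 \<omega>))"
    by (intro sum.cong swap) auto
  also have "\<dots> = real (Suc k) * expectation (\<lambda>\<omega>. \<phi> (S n \<omega>) * L 0 \<omega>)"
    by simp
  finally show ?thesis
    by (simp add: L_def leads_def del: of_nat_Suc)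
qed


section \<open>Bounds on the probability of outlasting a level\<close>

lemma prob_S_leads:
  assumes "k \<le> n"
  shows "prob {\<omega> \<in> space M. S n \<omega> > x \<and> leads k \<omega>} = prob {\<omega> \<in> space M. S n \<omega> > x} / real (Suc k)"
proof -
  have prob_of_bool: "expectation (\<lambda>\<omega>. of_bool (P \<omega>) :: real) = prob {\<omega> \<in> space M. P \<omega>}"
    if [measurable]: "Measurable.pred M P" for P
  proof -
    have "expectation (\<lambda>\<omega>. of_bool (P \<omega>) :: real) = expectation (indicator {\<omega> \<in> space M. P \<omega>})"
      by (intro Bochner_Integration.integral_cong) (auto simp: indicator_def)
    thus ?thesis by simp
  qed
  have "expectation (\<lambda>\<omega>. of_bool (S n \<omega> > x) * of_bool (leads k \<omega>) :: real) =
          expectation (\<lambda>\<omega>. of_bool (S n \<omega> > x)) / real (Suc k)"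
    by (rule expectation_leads[OF _ _ assms]) 
       (auto intro!: integrable_const_bound[where B = 1])
  thus ?thesis
    by (simp add: prob_of_bool flip: of_bool_conj)
qed

lemma prob_leads: "prob {\<omega> \<in> space M. leads k \<omega>} = 1 / real (Suc k)"
proof -
  have "{\<omega> \<in> space M. S k \<omega> > -1 \<and> P \<omega>} = {\<omega> \<in> space M. P \<omega>}" for P
    using S_nonneg[of _ k] by (intro Collect_cong) (auto simp: order.strict_trans2[of "-1" 0])
  from prob_S_leads[of k k "-1"] this[of "leads k"] this[of "\<lambda>_. True"] show ?thesis
    by (simp add: prob_space)
qed

text \<open>
  The factor \<open>j + 1\<close> in the expectation of \<open>S j\<close> is exactly cancelled by the probability that \<open>V 0\<close>
  leads, so these expectations do not grow with \<open>j\<close>. This makes the sum over \<open>j < k\<close> linear instead of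
  quadratic in \<open>k\<close>.
\<close>
lemma expectation_increment_leads:
  shows "integrable M (\<lambda>\<omega>. V (Suc j) \<omega> * (S j \<omega> * of_bool (leads j \<omega>)))" (is ?int)
    and "expectation (\<lambda>\<omega>. V (Suc j) \<omega> * (S j \<omega> * of_bool (leads j \<omega>))) = mean\<^sup>2" (is ?eq)
proof -
  have "indep_var (PiM {Suc j} (\<lambda>_. borel)) (\<lambda>\<omega>. restrict (\<lambda>i. V i \<omega>) {Suc j})
                  (PiM {..j} (\<lambda>_. borel)) (\<lambda>\<omega>. restrict (\<lambda>i. V i \<omega>) {..j})"
    by (rule indep_var_restrict[OF indep]) auto
  hence "indep_var borel ((\<lambda>y. y (Suc j)) \<circ> (\<lambda>\<omega>. restrict (\<lambda>i. V i \<omega>) {Suc j}))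
           borel ((\<lambda>y. (\<Sum>i\<le>j. y i) * of_bool (\<forall>i\<in>{..j}. y i \<le> y 0)) \<circ> (\<lambda>\<omega>. restrict (\<lambda>i. V i \<omega>) {..j}))"
  proof (rule indep_var_compose)
    note pred_coordinate_is_max[measurable]
    show "(\<lambda>y. (\<Sum>i\<le>j. y i) * of_bool (\<forall>i\<in>{..j}. y i \<le> y 0)) \<in> borel_measurable (\<Pi>\<^sub>M i\<in>{..j}. (borel :: real measure))"
      by measurable
  qed measurable
  also have "(\<lambda>y. y (Suc j)) \<circ> (\<lambda>\<omega>. restrict (\<lambda>i. V i \<omega>) {Suc j}) = V (Suc j)"
    by (simp add: comp_def)
  also have "(\<lambda>y. (\<Sum>i\<le>j. y i) * of_bool (\<forall>i\<in>{..j}. y i \<le> y 0)) \<circ> (\<lambda>\<omega>. restrict (\<lambda>i. V i \<omega>) {..j})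
      = (\<lambda>\<omega>. S j \<omega> * of_bool (leads j \<omega>))"
    by (auto simp: S_def leads_def fun_eq_iff)
  finally have ind: "indep_var borel (V (Suc j)) borel (\<lambda>\<omega>. S j \<omega> * of_bool (leads j \<omega>))" .
  have int: "integrable M (\<lambda>\<omega>. S j \<omega> * of_bool (leads j \<omega>))"
    by (rule Bochner_Integration.integrable_bound[OF integrable_S[of j]]) auto
  show ?int
    by (rule indep_var_integrable[OF ind integrable_V int])
  have "expectation (\<lambda>\<omega>. S j \<omega> * of_bool (leads j \<omega>)) = mean"
    using expectation_leads[of "\<lambda>x. x" j j] by (simp add: expectation_S del: of_nat_Suc)
  thus ?eq
    using indep_var_lebesgue_integral[OF ind integrable_V int]
    by (simp add: expectation_V power2_eq_square)
qed

text \<open>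
  At the first index \<open>n\<close> with \<open>S n > x\<close> the maximum of the first \<open>n + 1\<close> terms is \<open>V 0 \<le> x/2\<close>. Hence
  the sum of squares is at most half of \<open>x S n\<close>, and the pairwise products must make up the rest of
  \<open>(S n)\<^sup>2\<close>. All factors \<open>leads j\<close> with \<open>j < n\<close> are one, and the terms beyond \<open>n\<close> only add to
  the left-hand side, so \<open>n\<close> does not appear in the conclusion.
\<close>
lemma early_crossing_pays:
  assumes \<omega>: "\<omega> \<in> space M" and "outlasts x \<omega>" "S k \<omega> > x" "V 0 \<omega> \<le> x / 2" "x > 0"
  shows "(\<Sum>j<k. V (Suc j) \<omega> * (S j \<omega> * of_bool (leads j \<omega>))) \<ge> x\<^sup>2 / 4"
proof -
  define n where "n = (LEAST n. S n \<omega> > x)"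
  have Sn: "S n \<omega> > x" and "n \<le> k"
    unfolding n_def using assms by (auto intro: LeastI Least_le)
  have "S j \<omega> \<le> x" if "j < n" for j
    using not_less_Least[of j "\<lambda>n. S n \<omega> > x"] that unfolding n_def by auto
  hence max: "V i \<omega> \<le> V 0 \<omega>" if "i \<le> n" for i
    using \<open>outlasts x \<omega>\<close> that unfolding outlasts_def by (cases i) auto
  have "(\<Sum>i\<le>n. (V i \<omega>)\<^sup>2) \<le> (\<Sum>i\<le>n. x / 2 * V i \<omega>)"
  proof (rule sum_mono)
    fix i assume "i \<in> {..n}"
    hence "V i \<omega> \<le> x / 2" using max[of i] assms by auto
    thus "(V i \<omega>)\<^sup>2 \<le> x / 2 * V i \<omega>"
      unfolding power2_eq_square by (intro mult_right_mono V_nonneg \<omega>)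
  qed
  hence "(\<Sum>i\<le>n. (V i \<omega>)\<^sup>2) \<le> x / 2 * S n \<omega>"
    by (simp add: S_def sum_distrib_left)
  moreover have "x * (x / 2) \<le> S n \<omega> * (S n \<omega> - x / 2)"
    using Sn \<open>x > 0\<close> by (intro mult_mono) auto
  ultimately have "x\<^sup>2 / 2 \<le> (S n \<omega>)\<^sup>2 - (\<Sum>i\<le>n. (V i \<omega>)\<^sup>2)"
    by (simp add: power2_eq_square algebra_simps)
  also have "\<dots> = 2 * (\<Sum>j<n. V (Suc j) \<omega> * S j \<omega>)"
    unfolding S_def by (rule sum_increment_times_partial_sum[symmetric])
  also have "(\<Sum>j<n. V (Suc j) \<omega> * S j \<omega>) = (\<Sum>j<n. V (Suc j) \<omega> * (S j \<omega> * of_bool (leads j \<omega>)))"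
    using max by (intro sum.cong) (auto simp: leads_def)
  also have "\<dots> \<le> (\<Sum>j<k. V (Suc j) \<omega> * (S j \<omega> * of_bool (leads j \<omega>)))"
    using \<open>n \<le> k\<close> \<omega> by (intro sum_mono2) (auto intro!: mult_nonneg_nonneg V_nonneg S_nonneg)
  finally show ?thesis by simp
qed

lemma prob_early_crossing:
  assumes "x > 0"
  shows "prob {\<omega> \<in> space M. outlasts x \<omega> \<and> S k \<omega> > x \<and> V 0 \<omega> \<le> x / 2} \<le> 4 * k * mean\<^sup>2 / x\<^sup>2"
proof -
  define Y where "Y = (\<lambda>\<omega>. \<Sum>j<k. V (Suc j) \<omega> * (S j \<omega> * of_bool (leads j \<omega>)))"
  have int: "integrable M Y"
    unfolding Y_def by (intro Bochner_Integration.integrable_sum expectation_increment_leads)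
  have [measurable]: "Y \<in> borel_measurable M"
    unfolding Y_def by measurable
  have "prob {\<omega> \<in> space M. outlasts x \<omega> \<and> S k \<omega> > x \<and> V 0 \<omega> \<le> x / 2} 
          \<le> prob {\<omega> \<in> space M. Y \<omega> \<ge> x\<^sup>2 / 4}"
    using early_crossing_pays[OF _ _ _ _ assms] 
    by (intro finite_measure_mono) (auto simp: Y_def)
  also have "\<dots> \<le> expectation Y / (x\<^sup>2 / 4)"
    using assms by (intro integral_Markov_inequality_measure[OF int sets.empty_sets])
       (auto simp: Y_def intro!: AE_I2 sum_nonneg mult_nonneg_nonneg V_nonneg S_nonneg)
  also have "expectation Y = k * mean\<^sup>2"
    unfolding Y_def by (subst Bochner_Integration.integral_sum) (simp_all add: expectation_increment_leads)
  finally show ?thesis by (simp add: field_simps)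
qed

text \<open>
  If \<open>V 0\<close> is the largest of \<open>n + 1\<close> terms and their sum exceeds \<open>x\<close>, then \<open>x\<close> is passed
  before any term exceeds \<open>V 0\<close>.
\<close>
lemma prob_outlasts_ge: "prob {\<omega> \<in> space M. outlasts x \<omega>} \<ge> prob {\<omega> \<in> space M. S n \<omega> > x} / real (Suc n)"
proof -
  have "outlasts x \<omega>" if "\<omega> \<in> space M" "S n \<omega> > x" "leads n \<omega>" for \<omega>
    unfolding outlasts_def
  proof safe
    fix j assume "S j \<omega> \<le> x"
    hence "j < n" using S_mono[OF that(1), of n j] that(2) by force
    thus "V (Suc j) \<omega> \<le> V 0 \<omega>" using that(3) by (auto simp: leads_def)
  qed
  hence "prob {\<omega> \<in> space M. S n \<omega> > x \<and> leads n \<omega>} \<le> prob {\<omega> \<in> space M. outlasts x \<omega>}"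
    by (intro finite_measure_mono) auto
  thus ?thesis by (simp add: prob_S_leads del: of_nat_Suc)
qed

text \<open>
  The four summands belong to a first passage after \<open>l\<close>, a first passage after \<open>k\<close> but not after \<open>l\<close>,
  a large first term, and a first passage up to \<open>k\<close> without a large first term.
\<close>
lemma prob_outlasts_le:
  assumes "x > 0" "k \<le> l"
  shows "prob {\<omega> \<in> space M. outlasts x \<omega>} \<le> 
           1 / real (Suc l) + prob {\<omega> \<in> space M. S l \<omega> > x} / real (Suc k) +
           prob {\<omega> \<in> space M. V 0 \<omega> > x / 2} + 4 * k * mean\<^sup>2 / x\<^sup>2"
proof -
  let ?A = "{\<omega> \<in> space M. leads l \<omega>}" and ?B = "{\<omega> \<in> space M. S l \<omega> > x \<and> leads k \<omega>}"
    and ?C = "{\<omega> \<in> space M. V 0 \<omega> > x / 2}"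
    and ?E = "{\<omega> \<in> space M. outlasts x \<omega> \<and> S k \<omega> > x \<and> V 0 \<omega> \<le> x / 2}"
  have leads: "leads n \<omega>" if "\<omega> \<in> space M" "outlasts x \<omega>" "S n \<omega> \<le> x" for n \<omega>
    unfolding leads_def
  proof safe
    fix i assume "i \<le> n"
    show "V i \<omega> \<le> V 0 \<omega>"
    proof (cases i)
      case (Suc j)
      hence "S j \<omega> \<le> x" using S_mono[OF that(1), of j n] that(3) \<open>i \<le> n\<close> by simp
      thus ?thesis using that(2) Suc by (simp add: outlasts_def)
    qed simp
  qed
  have leads': "S n \<omega> > x" if "\<omega> \<in> space M" "outlasts x \<omega>" "\<not> leads n \<omega>" for n \<omega>
    using leads[OF that(1,2), of n] that(3) by linarith
  have "prob {\<omega> \<in> space M. outlasts x \<omega>} \<le> prob (?A \<union> ?B \<union> ?C \<union> ?E)"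
    using leads' by (intro finite_measure_mono) auto
  also have "\<dots> \<le> prob (?A \<union> ?B \<union> ?C) + prob ?E"
    by (rule measure_Un_le) auto
  also have "prob (?A \<union> ?B \<union> ?C) \<le> prob (?A \<union> ?B) + prob ?C"
    by (rule measure_Un_le) auto
  also have "prob (?A \<union> ?B) \<le> prob ?A + prob ?B"
    by (rule measure_Un_le) auto
  also have "prob ?A = 1 / real (Suc l)"
    by (rule prob_leads)
  also have "prob ?B = prob {\<omega> \<in> space M. S l \<omega> > x} / real (Suc k)"
    by (rule prob_S_leads) fact
  finally show ?thesis
    using prob_early_crossing[OF assms(1), of k] by linarith
qed

section \<open>Tails and the weak law of large numbers\<close>

lemma truncated_mean_tendsto: 
  "(\<lambda>c. expectation (\<lambda>\<omega>. min (V 0 \<omega>) (real c))) \<longlonglongrightarrow> mean"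
  unfolding mean_def
proof (rule integral_dominated_convergence[where w = "V 0"])
  show "AE \<omega> in M. (\<lambda>c. min (V 0 \<omega>) (real c)) \<longlonglongrightarrow> V 0 \<omega>"
  proof (rule AE_I2)
    fix \<omega>
    have "eventually (\<lambda>c. min (V 0 \<omega>) (real c) = V 0 \<omega>) sequentially"
      using eventually_ge_at_top[of "nat \<lceil>V 0 \<omega>\<rceil>"] by eventually_elim (rule min_absorb1, linarith)
    thus "(\<lambda>c. min (V 0 \<omega>) (real c)) \<longlonglongrightarrow> V 0 \<omega>"
      by (rule tendsto_eventually)
  qed
qed (use V_nonneg[of _ 0] integrable_V in auto)

text \<open>
  Markov's inequality restricted to the tail event; the expectation over the tail vanishes
  by dominated convergence.
\<close>
lemma tail_times_level_tendsto:
  "((\<lambda>x. x * prob {\<omega> \<in> space M. V 0 \<omega> > x}) \<longlongrightarrow> 0) at_top"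
proof -
  have lim: "((\<lambda>x. expectation (\<lambda>\<omega>. V 0 \<omega> * of_bool (V 0 \<omega> > x))) \<longlongrightarrow> expectation (\<lambda>_. 0)) at_top"
  proof (rule integral_dominated_convergence_at_top[where w = "V 0"])
    show "AE \<omega> in M. ((\<lambda>x. V 0 \<omega> * of_bool (V 0 \<omega> > x)) \<longlongrightarrow> 0) at_top"
    proof (rule AE_I2)
      fix \<omega>
      show "((\<lambda>x. V 0 \<omega> * of_bool (V 0 \<omega> > x)) \<longlongrightarrow> 0) at_top"
        by (rule tendsto_eventually, rule eventually_mono[OF eventually_ge_at_top[of "V 0 \<omega>"]]) auto
    qed
  qed (use V_nonneg[of _ 0] integrable_V in auto)
  show ?thesis
  proof (rule tendsto_sandwich[OF _ _ tendsto_const])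
    show "((\<lambda>x. expectation (\<lambda>\<omega>. V 0 \<omega> * of_bool (V 0 \<omega> > x))) \<longlongrightarrow> 0) at_top"
      using lim by simp
    show "\<forall>\<^sub>F x in at_top. 0 \<le> x * prob {\<omega> \<in> space M. V 0 \<omega> > x}"
      using eventually_ge_at_top[of 0] by eventually_elim auto
    show "\<forall>\<^sub>F x in at_top. x * prob {\<omega> \<in> space M. V 0 \<omega> > x} \<le> 
            expectation (\<lambda>\<omega>. V 0 \<omega> * of_bool (V 0 \<omega> > x))"
      using eventually_ge_at_top[of 0]
    proof eventually_elim
      case (elim x)
      have "x * prob {\<omega> \<in> space M. V 0 \<omega> > x} = 
              expectation (\<lambda>\<omega>. x * indicator {\<omega> \<in> space M. V 0 \<omega> > x} \<omega>)"
        by simp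
      also have "\<dots> \<le> expectation (\<lambda>\<omega>. V 0 \<omega> * of_bool (V 0 \<omega> > x))"
      proof (rule integral_mono)
        show "integrable M (\<lambda>\<omega>. x * indicator {\<omega> \<in> space M. V 0 \<omega> > x} \<omega>)"
          by (rule integrable_const_bound[where B = "\<bar>x\<bar>"]) (auto simp: indicator_def)
        show "integrable M (\<lambda>\<omega>. V 0 \<omega> * of_bool (V 0 \<omega> > x))"
          by (rule Bochner_Integration.integrable_bound[OF integrable_V[of 0]]) auto
      qed (use V_nonneg in \<open>auto simp: indicator_def\<close>)
      finally show ?case .
    qed
  qed
qed


text \<open>
  Only a first moment is at hand, so the terms are truncated at a level \<open>c\<close>. Hoeffding's inequality
  controls the truncated sum, and Markov's inequality the sum of the excesses, whose mean \<open>r\<close> is as small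
  as desired for large \<open>c\<close>.
\<close>
lemma weak_law_of_large_numbers:
  assumes "\<delta> > 0"
  shows "(\<lambda>n. prob {\<omega> \<in> space M. \<bar>S n \<omega> - real (Suc n) * mean\<bar> \<ge> \<delta> * real (Suc n)}) \<longlonglongrightarrow> 0"
proof (rule order_tendstoI)
  fix \<kappa> :: real assume "\<kappa> > 0"
  have "eventually (\<lambda>c. dist (expectation (\<lambda>\<omega>. min (V 0 \<omega>) (real c))) mean < min (\<delta> / 4) (\<kappa> * \<delta> / 8)) sequentially"
    using \<open>\<delta> > 0\<close> \<open>\<kappa> > 0\<close> by (intro tendstoD[OF truncated_mean_tendsto]) auto
  \<comment> \<open>Markov's inequality will bound the excess by \<open>4 * r / \<delta> \<le> \<kappa> / 2\<close>; the other bound on \<open>r\<close>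
     leaves a deviation of \<open>\<delta> / 2\<close> to the truncated sum.\<close>
  from eventually_happens'[OF sequentially_bot eventually_conj[OF this eventually_gt_at_top[of 0]]]
  obtain c where c: "c > 0"
    "dist (expectation (\<lambda>\<omega>. min (V 0 \<omega>) (real c))) mean < min (\<delta> / 4) (\<kappa> * \<delta> / 8)"
    by blast
  define W where "W i \<omega> = min (V i \<omega>) (real c)" for i \<omega>
  define r where "r = mean - expectation (W 0)"
  have r: "\<bar>r\<bar> < \<delta> / 4" "r < \<kappa> * \<delta> / 8"
    using c(2) unfolding r_def W_def dist_real_def min_less_iff_conj by linarith+
  have [measurable]: "W i \<in> borel_measurable M" for i
    unfolding W_def by measurable
  have int_W: "integrable M (W i)" for i
    unfolding W_def
    by (rule Bochner_Integration.integrable_bound[OF integrable_V[of i]]) (auto simp: V_nonneg)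
  have exp_W: "expectation (W i) = mean - r" for i
    using expectation_distr_V[of "\<lambda>x. min x (real c)" i 0] unfolding r_def W_def by simp
  define q where "q = exp (- (\<delta>\<^sup>2 / (2 * (real c)\<^sup>2)))"
  have bound: "prob {\<omega> \<in> space M. \<bar>S n \<omega> - real (Suc n) * mean\<bar> \<ge> \<delta> * real (Suc n)} \<le> 2 * q ^ Suc n + \<kappa> / 2"
    for n
  proof -
    define N where "N = real (Suc n)"
    have "N > 0" by (simp add: N_def)
    let ?A = "{\<omega> \<in> space M. \<bar>(\<Sum>i\<le>n. W i \<omega>) - (\<Sum>i\<le>n. expectation (W i))\<bar> \<ge> \<delta> / 2 * N}"
      and ?B = "{\<omega> \<in> space M. (\<Sum>i\<le>n. V i \<omega> - W i \<omega>) \<ge> \<delta> / 4 * N}"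
    interpret H: Hoeffding_ineq M "{..n}" W "\<lambda>_. 0" "\<lambda>_. real c" "\<Sum>i\<le>n. expectation (W i)"
    proof unfold_locales
      show "indep_vars (\<lambda>_. borel) W {..n}"
        unfolding W_def by (rule indep_vars_compose2[OF indep_vars_subset[OF indep]]) auto
    qed (auto simp: W_def V_nonneg)
    have "prob ?A \<le> 2 * exp (-2 * (\<delta> / 2 * N)\<^sup>2 / (\<Sum>i\<le>n. (real c - 0)\<^sup>2))"
      using \<open>\<delta> > 0\<close> \<open>N > 0\<close> \<open>c > 0\<close> by (intro H.Hoeffding_ineq_abs_ge) auto
    also have "-2 * (\<delta> / 2 * N)\<^sup>2 / (\<Sum>i\<le>n. (real c - 0)\<^sup>2) = real (Suc n) * (- (\<delta>\<^sup>2 / (2 * (real c)\<^sup>2)))"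
    proof -
      have "(\<Sum>i\<le>n. (real c - 0)\<^sup>2) = N * (real c)\<^sup>2"
        by (simp add: N_def)
      thus ?thesis
        unfolding N_def[symmetric] using \<open>N > 0\<close> \<open>c > 0\<close> by (simp add: field_simps power2_eq_square)
    qed
    also have "exp \<dots> = q ^ Suc n"
      unfolding q_def by (rule exp_of_nat_mult)
    finally have A: "prob ?A \<le> 2 * q ^ Suc n" .
    have "prob ?B \<le> expectation (\<lambda>\<omega>. \<Sum>i\<le>n. V i \<omega> - W i \<omega>) / (\<delta> / 4 * N)"
      using \<open>\<delta> > 0\<close> \<open>N > 0\<close>
      by (intro integral_Markov_inequality_measure[OF _ sets.empty_sets])
         (auto simp: int_W W_def intro!: AE_I2 sum_nonneg)
    also have "expectation (\<lambda>\<omega>. \<Sum>i\<le>n. V i \<omega> - W i \<omega>) = N * r"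
      by (simp add: int_W expectation_V exp_W N_def)
    also have "N * r / (\<delta> / 4 * N) \<le> \<kappa> / 2"
      using r(2) \<open>N > 0\<close> \<open>\<delta> > 0\<close> by (simp add: field_simps)
    finally have B: "prob ?B \<le> \<kappa> / 2" .
    have "{\<omega> \<in> space M. \<bar>S n \<omega> - N * mean\<bar> \<ge> \<delta> * N} \<subseteq> ?A \<union> ?B"
    proof safe
      fix \<omega> assume \<omega>: "\<omega> \<in> space M" "\<delta> * N \<le> \<bar>S n \<omega> - N * mean\<bar>"
        and nB: "\<not> \<delta> / 4 * N \<le> (\<Sum>i\<le>n. V i \<omega> - W i \<omega>)"
      define R where "R = (\<Sum>i\<le>n. V i \<omega> - W i \<omega>)"
      have "R \<ge> 0" unfolding R_def W_def by (intro sum_nonneg) auto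
      have split: "S n \<omega> - N * mean = ((\<Sum>i\<le>n. W i \<omega>) - (\<Sum>i\<le>n. expectation (W i))) + R - N * r"
        unfolding S_def R_def by (simp add: exp_W N_def sum_subtractf algebra_simps)
      have "\<bar>N * r\<bar> \<le> \<delta> / 4 * N"
        using r(1) \<open>N > 0\<close> by (simp add: abs_mult)
      thus "\<delta> / 2 * N \<le> \<bar>(\<Sum>i\<le>n. W i \<omega>) - (\<Sum>i\<le>n. expectation (W i))\<bar>"
        using \<omega>(2) nB \<open>R \<ge> 0\<close> unfolding R_def[symmetric] split by linarith
    qed
    hence "prob {\<omega> \<in> space M. \<bar>S n \<omega> - N * mean\<bar> \<ge> \<delta> * N} \<le> prob (?A \<union> ?B)"
      by (intro finite_measure_mono) auto
    also have "\<dots> \<le> prob ?A + prob ?B"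
      by (rule measure_Un_le) auto
    finally show ?thesis
      using A B unfolding N_def by linarith
  qed
  have "(\<lambda>n. 2 * q ^ Suc n) \<longlonglongrightarrow> 2 * 0"
    using \<open>\<delta> > 0\<close> \<open>c > 0\<close>
    by (intro tendsto_mult tendsto_const LIMSEQ_Suc LIMSEQ_power_zero) (auto simp: q_def)
  hence "eventually (\<lambda>n. 2 * q ^ Suc n < \<kappa> / 2) sequentially"
    by (rule order_tendstoD(2)) (use \<open>\<kappa> > 0\<close> in simp)
  thus "eventually (\<lambda>n. prob {\<omega> \<in> space M. \<bar>S n \<omega> - real (Suc n) * mean\<bar> \<ge> \<delta> * real (Suc n)} < \<kappa>) sequentially"
  proof eventually_elim
    case (elim n)
    thus ?case using bound[of n] by linarith
  qed
qed (auto intro!: always_eventually intro: less_le_trans)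

section \<open>Asymptotics\<close>

lemma S_below_mean_level_tendsto:
  assumes "mean > 0" "0 < \<epsilon>" "\<epsilon> < 1"
  shows "((\<lambda>x. prob {\<omega> \<in> space M. S (nat \<lfloor>(1 - \<epsilon>) / mean * x\<rfloor>) \<omega> > x}) \<longlongrightarrow> 0) at_top"
proof (rule tendsto_sandwich[OF _ _ tendsto_const])
  define l where "l x = nat \<lfloor>(1 - \<epsilon>) / mean * x\<rfloor>" for x
  let ?p = "\<lambda>n. prob {\<omega> \<in> space M. \<bar>S n \<omega> - real (Suc n) * mean\<bar> \<ge> \<epsilon> * mean * real (Suc n)}"
  show "((\<lambda>x. ?p (l x)) \<longlongrightarrow> 0) at_top"
    unfolding l_def using assms
    by (intro filterlim_compose[OF weak_law_of_large_numbers filterlim_nat_floor_mult]) auto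
  show "\<forall>\<^sub>F x in at_top. prob {\<omega> \<in> space M. S (l x) \<omega> > x} \<le> ?p (l x)"
    \<comment> \<open>The product \<open>(1 - \<epsilon>) * (1 + \<epsilon>) = 1 - \<epsilon>\<^sup>2\<close> leaves room \<open>\<epsilon>\<^sup>2 * x\<close>, which must absorb the one
       additional term in \<open>S (l x)\<close>.\<close>
    using eventually_ge_at_top[of "(1 + \<epsilon>) * mean / \<epsilon>\<^sup>2"]
  proof eventually_elim
    case (elim x)
    hence "(1 + \<epsilon>) * mean \<le> \<epsilon>\<^sup>2 * x"
      using assms by (simp add: field_simps)
    hence "x \<ge> 0" using assms
      by (smt (verit) mult_nonneg_nonneg mult_pos_neg zero_less_power)
    have "real (Suc (l x)) \<le> (1 - \<epsilon>) / mean * x + 1"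
      using assms \<open>x \<ge> 0\<close> unfolding l_def by (simp add: of_nat_nat)
    hence "real (Suc (l x)) * ((1 + \<epsilon>) * mean) \<le> ((1 - \<epsilon>) / mean * x + 1) * ((1 + \<epsilon>) * mean)"
      using assms by (intro mult_right_mono) auto
    also have "\<dots> = x - \<epsilon>\<^sup>2 * x + (1 + \<epsilon>) * mean"
      using assms by (simp add: field_simps power2_eq_square)
    also have "\<dots> \<le> x"
      using \<open>(1 + \<epsilon>) * mean \<le> \<epsilon>\<^sup>2 * x\<close> by simp
    finally have "real (Suc (l x)) * mean + \<epsilon> * mean * real (Suc (l x)) \<le> x"
      by (simp add: algebra_simps)
    thus ?case by (intro finite_measure_mono) auto
  qed
qed auto

lemma S_above_mean_level_tendsto:
  assumes "mean > 0" "0 < \<epsilon>" "\<epsilon> < 1"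
  shows "((\<lambda>x. prob {\<omega> \<in> space M. S (nat \<lfloor>1 / (mean * (1 - \<epsilon>)) * x\<rfloor>) \<omega> > x}) \<longlongrightarrow> 1) at_top"
proof (rule tendsto_sandwich[OF _ _ _ tendsto_const])
  define l where "l x = nat \<lfloor>1 / (mean * (1 - \<epsilon>)) * x\<rfloor>" for x
  let ?p = "\<lambda>n. prob {\<omega> \<in> space M. \<bar>S n \<omega> - real (Suc n) * mean\<bar> \<ge> \<epsilon> * mean * real (Suc n)}"
  have "((\<lambda>x. ?p (l x)) \<longlongrightarrow> 0) at_top"
    unfolding l_def using assms
    by (intro filterlim_compose[OF weak_law_of_large_numbers filterlim_nat_floor_mult]) auto
  from tendsto_diff[OF tendsto_const this, of 1]
  show "((\<lambda>x. 1 - ?p (l x)) \<longlongrightarrow> 1) at_top" by simp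
  have "1 - ?p (l x) \<le> prob {\<omega> \<in> space M. S (l x) \<omega> > x}" for x
  proof -
    have "1 / (mean * (1 - \<epsilon>)) * x \<le> real (Suc (l x))"
      unfolding l_def by linarith
    hence "x \<le> real (Suc (l x)) * (mean * (1 - \<epsilon>))"
      using assms by (simp add: field_simps)
    hence "x \<le> real (Suc (l x)) * mean - \<epsilon> * mean * real (Suc (l x))"
      by (simp add: algebra_simps)
    hence "prob {\<omega> \<in> space M. \<not> S (l x) \<omega> > x} \<le> ?p (l x)"
      by (intro finite_measure_mono) auto
    thus ?thesis by (subst (asm) prob_neg) auto
  qed
  thus "\<forall>\<^sub>F x in at_top. 1 - ?p (l x) \<le> prob {\<omega> \<in> space M. S (l x) \<omega> > x}"
    by (intro always_eventually) auto
qed auto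

lemma eventually_level_times_prob_outlasts_gt:
  assumes "mean > 0" "a < mean"
  shows "\<forall>\<^sub>F x in at_top. a < x * prob {\<omega> \<in> space M. outlasts x \<omega>}"
proof -
  have "((\<lambda>\<epsilon>. mean * (1 - \<epsilon>)) \<longlongrightarrow> mean * (1 - 0)) (at_right 0)"
    by (intro tendsto_intros)
  hence "\<forall>\<^sub>F \<epsilon> in at_right 0. a < mean * (1 - \<epsilon>)"
    using assms by (intro order_tendstoD) auto
  moreover have "\<forall>\<^sub>F \<epsilon> in at_right 0. \<epsilon> \<in> {0<..<(1::real)}"
    by (rule eventually_at_right_real) auto
  ultimately have "\<forall>\<^sub>F \<epsilon> in at_right 0. a < mean * (1 - \<epsilon>) \<and> \<epsilon> \<in> {0<..<(1::real)}"
    by eventually_elim auto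
  from eventually_happens'[OF trivial_limit_at_right_real this]
  obtain \<epsilon> where \<epsilon>: "0 < \<epsilon>" "\<epsilon> < 1" "a < mean * (1 - \<epsilon>)"
    unfolding greaterThanLessThan_iff by blast
  define b where "b = mean * (1 - \<epsilon>)"
  have "b > 0" using \<epsilon> assms by (simp add: b_def)
  let ?P = "\<lambda>x. prob {\<omega> \<in> space M. S (nat \<lfloor>1 / b * x\<rfloor>) \<omega> > x}"
  have "((\<lambda>x. 1 / (1 / b + 1 / x) * ?P x) \<longlongrightarrow> 1 / (1 / b + 0) * 1) at_top"
    using S_above_mean_level_tendsto[OF assms(1) \<epsilon>(1,2)] \<open>b > 0\<close> unfolding b_def[symmetric]
    by (intro tendsto_intros tendsto_divide_0[OF tendsto_const] filterlim_at_top_imp_at_infinity filterlim_ident) auto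
  hence "\<forall>\<^sub>F x in at_top. a < 1 / (1 / b + 1 / x) * ?P x"
    using \<epsilon> \<open>b > 0\<close> by (intro order_tendstoD) (auto simp: b_def)
  thus ?thesis
    using eventually_gt_at_top[of 0]
  proof eventually_elim
    case (elim x)
    define n where "n = nat \<lfloor>1 / b * x\<rfloor>"
    have "real (Suc n) \<le> 1 / b * x + 1"
      unfolding n_def using \<open>x > 0\<close> \<open>b > 0\<close> by (simp add: of_nat_nat)
    hence "x / (1 / b * x + 1) \<le> x / real (Suc n)"
      using \<open>x > 0\<close> \<open>b > 0\<close> by (intro divide_left_mono mult_pos_pos add_pos_pos) auto
    moreover have "1 / (1 / b + 1 / x) = x / (1 / b * x + 1)"
      using \<open>x > 0\<close> \<open>b > 0\<close> by (simp add: field_simps)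
    ultimately have "1 / (1 / b + 1 / x) * ?P x \<le> x / real (Suc n) * ?P x"
      by (intro mult_right_mono) auto
    also have "\<dots> = x * (?P x / real (Suc n))" by simp
    also have "\<dots> \<le> x * prob {\<omega> \<in> space M. outlasts x \<omega>}"
      unfolding n_def using \<open>x > 0\<close> by (intro mult_left_mono prob_outlasts_ge) auto
    finally show ?case using elim by linarith
  qed
qed

lemma eventually_level_times_prob_outlasts_lt:
  assumes "mean > 0" "a > mean"
  shows "\<forall>\<^sub>F x in at_top. x * prob {\<omega> \<in> space M. outlasts x \<omega>} < a"
proof -
  have "((\<lambda>\<epsilon>. mean / (1 - \<epsilon>) + 4 * \<epsilon> * mean) \<longlongrightarrow> mean / (1 - 0) + 4 * 0 * mean) (at_right 0)"
    by (intro tendsto_intros) auto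
  hence "\<forall>\<^sub>F \<epsilon> in at_right 0. mean / (1 - \<epsilon>) + 4 * \<epsilon> * mean < a"
    using assms by (intro order_tendstoD) auto
  moreover have "\<forall>\<^sub>F \<epsilon> in at_right 0. \<epsilon> \<in> {0<..<(1/2::real)}"
    by (rule eventually_at_right_real) auto
  ultimately have "\<forall>\<^sub>F \<epsilon> in at_right 0. mean / (1 - \<epsilon>) + 4 * \<epsilon> * mean < a \<and> \<epsilon> \<in> {0<..<(1/2::real)}"
    by eventually_elim auto
  from eventually_happens'[OF trivial_limit_at_right_real this]
  obtain \<epsilon> where \<epsilon>: "0 < \<epsilon>" "\<epsilon> < 1/2" "mean / (1 - \<epsilon>) + 4 * \<epsilon> * mean < a"
    unfolding greaterThanLessThan_iff by blast
  define b where "b = (1 - \<epsilon>) / mean"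
  have "b > 0" using \<epsilon> assms by (simp add: b_def)
  let ?P = "\<lambda>x. prob {\<omega> \<in> space M. S (nat \<lfloor>b * x\<rfloor>) \<omega> > x}"
    and ?Q = "\<lambda>x. prob {\<omega> \<in> space M. V 0 \<omega> > x / 2}"
  have Q: "((\<lambda>x. x / 2 * ?Q x) \<longlongrightarrow> 0) at_top"
    by (rule filterlim_compose[OF tail_times_level_tendsto])
       (use filterlim_tendsto_pos_mult_at_top[OF tendsto_const[of "1/2"] _ filterlim_ident] in simp)
  have "((\<lambda>x. mean / (1 - \<epsilon>) + mean / \<epsilon> * ?P x + 2 * (x / 2 * ?Q x) + 4 * \<epsilon> * mean) 
          \<longlongrightarrow> mean / (1 - \<epsilon>) + mean / \<epsilon> * 0 + 2 * 0 + 4 * \<epsilon> * mean) at_top"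
    using S_below_mean_level_tendsto[OF assms(1), of \<epsilon>] \<epsilon> unfolding b_def[symmetric]
    by (intro tendsto_add tendsto_mult tendsto_const Q) auto
  hence "\<forall>\<^sub>F x in at_top. mean / (1 - \<epsilon>) + mean / \<epsilon> * ?P x + 2 * (x / 2 * ?Q x) + 4 * \<epsilon> * mean < a"
    using \<epsilon> by (intro order_tendstoD) auto
  thus ?thesis
    using eventually_gt_at_top[of 0]
  proof eventually_elim
    case (elim x)
    define l k where "l = nat \<lfloor>b * x\<rfloor>" and "k = nat \<lfloor>\<epsilon> / mean * x\<rfloor>"
    \<comment> \<open>This is where \<open>\<epsilon> < 1/2\<close> enters: it makes \<open>\<epsilon> \<le> 1 - \<epsilon>\<close>.\<close>
    have "\<epsilon> / mean * x \<le> b * x"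
      unfolding b_def using \<epsilon> assms \<open>x > 0\<close> by (intro mult_right_mono divide_right_mono) auto
    hence "k \<le> l" unfolding k_def l_def by (intro nat_mono floor_mono)
    have "b * x \<le> real (Suc l)" "\<epsilon> / mean * x \<le> real (Suc k)"
      unfolding l_def k_def by linarith+
    have l: "x * (1 / real (Suc l)) \<le> mean / (1 - \<epsilon>)"
    proof -
      have "x * (1 - \<epsilon>) \<le> mean * real (Suc l)"
        using \<open>b * x \<le> real (Suc l)\<close> assms unfolding b_def by (simp add: field_simps)
      thus ?thesis using \<epsilon> by (simp add: divide_simps mult_ac del: of_nat_Suc)
    qed
    have k: "x / real (Suc k) \<le> mean / \<epsilon>"
    proof -
      have "x * \<epsilon> \<le> mean * real (Suc k)"
        using \<open>\<epsilon> / mean * x \<le> real (Suc k)\<close> assms by (simp add: field_simps)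
      thus ?thesis using \<epsilon> by (simp add: divide_simps mult_ac del: of_nat_Suc)
    qed
    have "real k \<le> \<epsilon> / mean * x"
      unfolding k_def using \<epsilon> assms \<open>x > 0\<close> by (simp add: of_nat_nat)
    hence "4 * real k * mean\<^sup>2 / x\<^sup>2 \<le> 4 * (\<epsilon> / mean * x) * mean\<^sup>2 / x\<^sup>2"
      by (intro divide_right_mono mult_right_mono mult_left_mono) auto
    also have "\<dots> = 4 * \<epsilon> * mean / x"
      using assms \<open>x > 0\<close> by (simp add: field_simps power2_eq_square)
    finally have early: "x * (4 * real k * mean\<^sup>2 / x\<^sup>2) \<le> 4 * \<epsilon> * mean"
      using \<open>x > 0\<close> by (simp add: field_simps)
    have "x * prob {\<omega> \<in> space M. outlasts x \<omega>} \<le> 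
            x * (1 / real (Suc l) + ?P x / real (Suc k) + ?Q x + 4 * k * mean\<^sup>2 / x\<^sup>2)"
      using prob_outlasts_le[OF \<open>x > 0\<close> \<open>k \<le> l\<close>] \<open>x > 0\<close>
      unfolding l_def by (intro mult_left_mono) auto
    also have "\<dots> = x * (1 / real (Suc l)) + x / real (Suc k) * ?P x + 2 * (x / 2 * ?Q x) + 
                     x * (4 * real k * mean\<^sup>2 / x\<^sup>2)"
      by (simp add: algebra_simps del: of_nat_Suc)
    also have "\<dots> \<le> mean / (1 - \<epsilon>) + mean / \<epsilon> * ?P x + 2 * (x / 2 * ?Q x) + 4 * \<epsilon> * mean"
      by (intro add_mono mult_right_mono l k early order_refl) auto
    also note \<open>\<dots> < a\<close>
    finally show ?case .
  qed
qed

lemma level_times_prob_outlasts_tendsto: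
  assumes "mean > 0"
  shows "((\<lambda>x. x * prob {\<omega> \<in> space M. outlasts x \<omega>}) \<longlongrightarrow> mean) at_top"
  using eventually_level_times_prob_outlasts_gt[OF assms] 
    eventually_level_times_prob_outlasts_lt[OF assms] by (rule order_tendstoI)

end

section \<open>The RESTART model\<close>

text \<open>
  If \<open>V (m + 1)\<close> is the first term beyond \<open>V 0\<close>, the total time is the partial sum up to \<open>m\<close>. As partial
  sums increase, it exceeds \<open>x\<close> iff every index with partial sum at most \<open>x\<close> is smaller than \<open>m\<close>. If there
  is no such \<open>m\<close>, the total time is infinite and the right-hand side holds as well.
\<close>
lemma restart_X_gt_iff:
  fixes T :: "'a \<Rightarrow> real" and U :: "nat \<Rightarrow> 'a \<Rightarrow> real" and \<omega> x
  defines "V \<equiv> \<lambda>n. if n = 0 then T \<omega> else U n \<omega>"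
  assumes nonneg: "\<And>n. V n \<ge> 0"
  shows "restart_X T U \<omega> > ereal x \<longleftrightarrow> (\<forall>n. (\<Sum>i\<le>n. V i) \<le> x \<longrightarrow> V (Suc n) \<le> V 0)"
proof (cases "\<forall>n. V (Suc n) \<le> V 0")
  case True
  hence "{enat n | n. U (n + 1) \<omega> > T \<omega>} = {}"
    by (auto simp: V_def not_less)
  hence "restart_N T U \<omega> = \<infinity>"
    by (simp add: restart_N_def top_enat_def)
  thus ?thesis using True by (simp add: restart_X_def restart_S_def)
next
  case False
  define m where "m = (LEAST n. V (Suc n) > V 0)"
  have "\<exists>n. V (Suc n) > V 0"
    using False by (simp add: not_le)
  hence m: "V (Suc m) > V 0"
    unfolding m_def by (rule LeastI_ex)
  have m_le: "m \<le> n" if "V (Suc n) > V 0" for n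
    unfolding m_def using that by (rule Least_le)
  have "restart_N T U \<omega> = enat m"
    unfolding restart_N_def
  proof (rule antisym)
    show "Inf {enat n | n. U (n + 1) \<omega> > T \<omega>} \<le> enat m"
      using m by (intro Inf_lower) (auto simp: V_def)
    show "enat m \<le> Inf {enat n | n. U (n + 1) \<omega> > T \<omega>}"
      using m_le by (intro Inf_greatest) (auto simp: V_def)
  qed
  moreover have "T \<omega> + (\<Sum>i=1..n. U i \<omega>) = (\<Sum>i\<le>n. V i)" for n
    by (induction n) (simp_all add: V_def)
  ultimately have X: "restart_X T U \<omega> = ereal (\<Sum>i\<le>m. V i)"
    by (simp add: restart_X_def restart_S_def)
  have mono: "(\<Sum>i\<le>m. V i) \<le> (\<Sum>i\<le>n. V i)" if "m \<le> n" for n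
    using that nonneg by (intro sum_mono2) auto
  show ?thesis
  proof
    assume "restart_X T U \<omega> > ereal x"
    hence "(\<Sum>i\<le>m. V i) > x" by (simp add: X)
    thus "\<forall>n. (\<Sum>i\<le>n. V i) \<le> x \<longrightarrow> V (Suc n) \<le> V 0"
      using mono m_le by (meson leD leI order_trans)
  next
    assume "\<forall>n. (\<Sum>i\<le>n. V i) \<le> x \<longrightarrow> V (Suc n) \<le> V 0"
    thus "restart_X T U \<omega> > ereal x"
      using m unfolding X by (meson leD leI less_ereal.simps(1))
  qed
qed

lemma (in restart_model) iid_diffuse_sequence_restart:
  assumes "F = G" "integrable M (U 1)"
  shows "iid_diffuse_sequence M (\<lambda>n. if n = 0 then T else U n) G"
proof unfold_locales
  show "indep_vars (\<lambda>_. borel) (\<lambda>n. if n = 0 then T else U n) UNIV"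
    by (rule indep)
  show "distr M borel (if n = 0 then T else U n) = G" for n
    using T_distr U_distr[of n] assms(1) by simp
  show "0 \<le> (if n = 0 then T else U n) \<omega>" if "\<omega> \<in> space M" for n \<omega>
    using T_nonneg U_nonneg[of n] that by simp
  show "emeasure G {a} = 0" for a
  proof -
    have "emeasure G {a} = emeasure M (T -` {a} \<inter> space M)"
      using T_rv unfolding assms(1)[symmetric] T_distr[symmetric] by (simp add: emeasure_distr)
    also have "\<dots> = (\<integral>\<^sup>+t. ennreal (f t) * indicator {0..} t * indicator {a} t \<partial>lborel)"
      by (rule distributed_emeasure[OF T_density]) simp
    also have "\<dots> = 0"
      by (rule nn_integral_null_set) (simp add: null_sets_def)
    finally show ?thesis .
  qed
  have "integrable (distr M borel (U 1)) (\<lambda>x. x)"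
    using assms(2) U_rv[of 1] by (simp add: integrable_distr_eq)
  also have "distr M borel (U 1) = distr M borel T"
    using U_distr[of 1] T_distr assms(1) by simp
  finally have "integrable M T"
    using T_rv by (simp add: integrable_distr_eq)
  thus "integrable M (if 0 = (0::nat) then T else U 0)" by simp
qed

theorem proposition1p1:
  fixes M :: "'a measure"
    and T :: "'a \<Rightarrow> real" and U :: "nat \<Rightarrow> 'a \<Rightarrow> real"
    and F G :: "real measure" and f g :: "real \<Rightarrow> real" and \<mu> :: real
  assumes "restart_model M T U F G f g"
    and "integrable M (U 1)"
    and "\<mu> = 1 / (\<integral>\<omega>. U 1 \<omega> \<partial>M)"
    and "\<mu> > 0"
    and "\<not> bounded (measure_support F)"
    and "F = G"
  shows "(\<lambda>x. restart_Hbar M T U x) \<sim>[at_top] (\<lambda>x. 1 / (\<mu> * x))"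
proof -
  interpret restart_model M T U F G f g by fact
  define V where "V = (\<lambda>n. if n = 0 then T else U n)"
  interpret iid_diffuse_sequence M V G
    unfolding V_def using assms by (intro iid_diffuse_sequence_restart)
  have mean: "mean = 1 / \<mu>"
    using expectation_V[of 1] assms(3) by (simp add: V_def)
  have Hbar: "restart_Hbar M T U x = prob {\<omega> \<in> space M. outlasts x \<omega>}" for x
  proof -
    have "restart_X T U \<omega> > ereal x \<longleftrightarrow> outlasts x \<omega>" if "\<omega> \<in> space M" for \<omega>
    proof -
      have eq: "V n \<omega> = (if n = 0 then T \<omega> else U n \<omega>)" for n
        by (simp add: V_def)
      show ?thesis
        unfolding outlasts_def S_def eq
        by (rule restart_X_gt_iff) (use V_nonneg[OF that] eq in metis)
    qed
    thus ?thesis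
      unfolding restart_Hbar_def by (intro arg_cong[of _ _ prob] Collect_cong) auto
  qed
  have "((\<lambda>x. \<mu> * (x * restart_Hbar M T U x)) \<longlongrightarrow> \<mu> * mean) at_top"
    unfolding Hbar using assms(4)
    by (intro tendsto_mult tendsto_const level_times_prob_outlasts_tendsto) (simp add: mean)
  hence "((\<lambda>x. restart_Hbar M T U x / (1 / (\<mu> * x))) \<longlongrightarrow> 1) at_top"
    using assms(4) by (simp add: mean mult_ac)
  thus ?thesis by (rule asymp_equivI')
qed

end
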